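(* Let $G$ be an undirected, connected, loop-free multigraph with $n\ge 2$ vertices and genus $g\ge 1$. If $G$ is dense, then the $\mathbb{R}$-gonality of $G$ is at most $\lceil (g+2)/2\rceil$. More generally, if $G$ has stretch factor $\kappa$, then the $\mathbb{R}$-gonality of $G$ is at most $$\left\lceil \frac{(2\kappa-1)g}{2\kappa}+1\right\rceil .$$
   Context: For a connected, loop-free multigraph $G=(V,E)$ with $n$ vertices and $m$ edges, the genus is $g=m-n+1$. $G$ is dense if $m\ge n(n-1)$ (equivalently $g\ge (n-1)^2$). The stretch factor $\kappa$ of $G$ is $\max\{\lceil n(n-1)/m\rceil,1\}$. An $\mathbb{R}$-divisor on $G$ is a formal sum $\sum_{v\in V}a_v(v)$ with $a_v\in\mathbb{R}$; its degree is $\sum_v a_v$; it is effective if $a_v\ge 0$ for all $v$. For $f:V\to\mathbb{Z}$ let $Q(f)=\sum_{v\in V}\big(\sum_{(u,v)\in E}(f(v)-f(u))\big)(v)$ (edges counted with multiplicity). Two $\mathbb{R}$-divisors $D_1,D_2$ are linearly equivalent if $D_1-D_2=Q(f)$ for some $f:V\to\mathbb{Z}$. The linear system $|D|$ is the set of effective $\mathbb{R}$-divisors linearly equivalent to $D$. The modified rank $\tilde r(D)$ is $k_0-1$, where $k_0$ is the infimum of all $k$ such that there is an effective $\mathbb{R}$-divisor $E$ of degree $k$ with $|D-E|=\emptyset$. The rank of $D$ is $r(D)=\tilde r\big(D+\sum_{v\in V}(v)\big)$. The $\mathbb{R}$-gonality of $G$ is the infimum of the degrees of all $\mathbb{R}$-divisors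 on $G$ of rank at least one. *)

theory Defs
  imports Complex_Main "HOL-Library.Multiset"
begin

text \<open>
  A finite undirected loop-free multigraph is a finite vertex set together with a multiset of edges,
  each edge being a two-element set of vertices; \<^term>\<open>count E {u, v}\<close> is the number of parallel
  edges between \<open>u\<close> and \<open>v\<close>.
\<close>

definition loopfree_multigraph :: "'a set \<Rightarrow> 'a set multiset \<Rightarrow> bool" where
  "loopfree_multigraph V E \<longleftrightarrow> finite V \<and> (\<forall>e \<in># E. e \<subseteq> V \<and> card e = 2)"

definition connected_multigraph :: "'a set \<Rightarrow> 'a set multiset \<Rightarrow> bool" where
  "connected_multigraph V E \<longleftrightarrow> V \<noteq> {} \<and> (\<forall>u\<in>V. \<forall>v\<in>V. (u, v) \<in> {(x, y). {x, y} \<in># E}\<^sup>*)"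

definition genus :: "'a set \<Rightarrow> 'a set multiset \<Rightarrow> int" where
  "genus V E = int (size E) - int (card V) + 1"

definition dense_multigraph :: "'a set \<Rightarrow> 'a set multiset \<Rightarrow> bool" where
  "dense_multigraph V E \<longleftrightarrow> size E \<ge> card V * (card V - 1)"

definition stretch_factor :: "'a set \<Rightarrow> 'a set multiset \<Rightarrow> int" where
  "stretch_factor V E = max \<lceil>real (card V * (card V - 1)) / real (size E)\<rceil> 1"

text \<open>A divisor is represented by its coefficient function, extended by zero outside \<open>V\<close>.\<close>

definition divisors :: "'a set \<Rightarrow> ('a \<Rightarrow> real) set" where
  "divisors V = {D. \<forall>v. v \<notin> V \<longrightarrow> D v = 0}"

definition divisor_deg :: "'a set \<Rightarrow> ('a \<Rightarrow> real) \<Rightarrow> real" where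
  "divisor_deg V D = (\<Sum>v\<in>V. D v)"

definition effective_divisors :: "'a set \<Rightarrow> ('a \<Rightarrow> real) set" where
  "effective_divisors V = {D \<in> divisors V. \<forall>v\<in>V. D v \<ge> 0}"

text \<open>
  Summing over the edges at \<open>v\<close> with multiplicity amounts to summing over all vertices \<open>u\<close> with
  weight \<^term>\<open>count E {u, v}\<close>; the weight is zero for \<open>u = v\<close>, and for \<open>v\<close> outside \<open>V\<close>.
\<close>

definition laplacian :: "'a set \<Rightarrow> 'a set multiset \<Rightarrow> ('a \<Rightarrow> int) \<Rightarrow> 'a \<Rightarrow> real" where
  "laplacian V E f v = (\<Sum>u\<in>V. real (count E {u, v}) * real_of_int (f v - f u))"

definition lin_equiv ::
    "'a set \<Rightarrow> 'a set multiset \<Rightarrow> ('a \<Rightarrow> real) \<Rightarrow> ('a \<Rightarrow> real) \<Rightarrow> bool" where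
  "lin_equiv V E D1 D2 \<longleftrightarrow> (\<exists>f :: 'a \<Rightarrow> int. \<forall>v. D1 v - D2 v = laplacian V E f v)"

definition linear_system ::
    "'a set \<Rightarrow> 'a set multiset \<Rightarrow> ('a \<Rightarrow> real) \<Rightarrow> ('a \<Rightarrow> real) set" where
  "linear_system V E D = {D' \<in> effective_divisors V. lin_equiv V E D' D}"

text \<open>
  The infima below are taken in the reals; the lemmas at the end show that they range over nonempty
  sets that are bounded below.
\<close>

definition unwinnable_degrees ::
    "'a set \<Rightarrow> 'a set multiset \<Rightarrow> ('a \<Rightarrow> real) \<Rightarrow> real set" where
  "unwinnable_degrees V E D =
    {k. \<exists>F \<in> effective_divisors V. divisor_deg V F = k \<and> linear_system V E (\<lambda>v. D v - F v) = {}}"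

definition modified_rank :: "'a set \<Rightarrow> 'a set multiset \<Rightarrow> ('a \<Rightarrow> real) \<Rightarrow> real" where
  "modified_rank V E D = Inf (unwinnable_degrees V E D) - 1"

definition divisor_rank :: "'a set \<Rightarrow> 'a set multiset \<Rightarrow> ('a \<Rightarrow> real) \<Rightarrow> real" where
  "divisor_rank V E D = modified_rank V E (\<lambda>v. D v + of_bool (v \<in> V))"

definition gonality :: "'a set \<Rightarrow> 'a set multiset \<Rightarrow> real" where
  "gonality V E = Inf (divisor_deg V ` {D \<in> divisors V. divisor_rank V E D \<ge> 1})"


lemma deg_laplacian: "divisor_deg V (laplacian V E f) = 0"
proof -
  let ?c = "\<lambda>u v. real (count E {u, v})"
  have "divisor_deg V (laplacian V E f) =
      (\<Sum>v\<in>V. \<Sum>u\<in>V. ?c u v * real_of_int (f v)) - (\<Sum>v\<in>V. \<Sum>u\<in>V. ?c u v * real_of_int (f u))"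
    by (simp add: divisor_deg_def laplacian_def algebra_simps sum_subtractf)
  also have "(\<Sum>v\<in>V. \<Sum>u\<in>V. ?c u v * real_of_int (f u)) = (\<Sum>v\<in>V. \<Sum>u\<in>V. ?c u v * real_of_int (f v))"
    by (subst sum.swap) (simp add: insert_commute)
  finally show ?thesis by simp
qed

lemma deg_lin_equiv:
  assumes "lin_equiv V E D1 D2"
  shows "divisor_deg V D1 = divisor_deg V D2"
proof -
  obtain f where f: "\<And>v. D1 v - D2 v = laplacian V E f v"
    using assms by (auto simp: lin_equiv_def)
  have "divisor_deg V D1 - divisor_deg V D2 = divisor_deg V (laplacian V E f)"
    by (simp add: divisor_deg_def f flip: sum_subtractf)
  then show ?thesis by (simp add: deg_laplacian)
qed

lemma linear_system_empty_if_deg_neg: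
  assumes "divisor_deg V D < 0"
  shows "linear_system V E D = {}"
proof -
  have "divisor_deg V D' \<ge> 0" if "D' \<in> effective_divisors V" for D'
    using that by (auto simp: effective_divisors_def divisor_deg_def intro: sum_nonneg)
  then show ?thesis
    using assms deg_lin_equiv by (fastforce simp: linear_system_def)
qed

lemma bdd_below_unwinnable_degrees: "bdd_below (unwinnable_degrees V E D)"
  by (rule bdd_belowI[of _ 0])
    (auto simp: unwinnable_degrees_def effective_divisors_def divisor_deg_def intro: sum_nonneg)

lemma unwinnable_degrees_nonempty:
  assumes "finite V" "V \<noteq> {}"
  shows "unwinnable_degrees V E D \<noteq> {}"
proof -
  obtain w where w: "w \<in> V" using assms by auto
  define F where "F = (\<lambda>v. if v = w then \<bar>divisor_deg V D\<bar> + 1 else 0)"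
  have F: "F \<in> effective_divisors V" "divisor_deg V F = \<bar>divisor_deg V D\<bar> + 1"
    using assms w by (auto simp: F_def effective_divisors_def divisors_def divisor_deg_def)
  have "divisor_deg V (\<lambda>v. D v - F v) = divisor_deg V D - divisor_deg V F"
    by (simp add: divisor_deg_def sum_subtractf)
  then have "linear_system V E (\<lambda>v. D v - F v) = {}"
    using F by (intro linear_system_empty_if_deg_neg) auto
  with F show ?thesis by (auto simp: unwinnable_degrees_def)
qed

lemma bdd_below_degrees_rank_ge_1:
  "bdd_below (divisor_deg V ` {D \<in> divisors V. divisor_rank V E D \<ge> 1})"
proof (rule bdd_belowI2[of _ "- real (card V)"])
  fix D assume "D \<in> {D \<in> divisors V. divisor_rank V E D \<ge> 1}"
  then have r: "divisor_rank V E D \<ge> 1" by simp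
  show "- real (card V) \<le> divisor_deg V D"
  proof (rule ccontr)
    assume "\<not> ?thesis"
    then have "divisor_deg V (\<lambda>v. D v + of_bool (v \<in> V)) < 0"
      by (simp add: divisor_deg_def sum.distrib)
    from linear_system_empty_if_deg_neg[OF this]
    have "0 \<in> unwinnable_degrees V E (\<lambda>v. D v + of_bool (v \<in> V))"
      by (auto simp: unwinnable_degrees_def effective_divisors_def divisors_def divisor_deg_def
          intro!: bexI[of _ "\<lambda>_. 0"])
    from cInf_lower[OF this bdd_below_unwinnable_degrees] r show False
      by (simp add: divisor_rank_def modified_rank_def)
  qed
qed

lemma exists_rank_ge_1:
  assumes "finite V" "V \<noteq> {}"
  shows "divisor_deg V ` {D \<in> divisors V. divisor_rank V E D \<ge> 1} \<noteq> {}"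
proof -
  define D :: "'a \<Rightarrow> real" where "D = (\<lambda>v. of_bool (v \<in> V))"
  have D: "D \<in> divisors V" by (simp add: D_def divisors_def)
  have "k \<ge> 2" if "k \<in> unwinnable_degrees V E (\<lambda>v. D v + of_bool (v \<in> V))" for k
  proof (rule ccontr)
    assume k: "\<not> k \<ge> 2"
    obtain F where F: "F \<in> effective_divisors V" "divisor_deg V F = k"
        "linear_system V E (\<lambda>v. D v + of_bool (v \<in> V) - F v) = {}"
      using \<open>k \<in> _\<close> by (auto simp: unwinnable_degrees_def)
    have "F v \<le> 2" if "v \<in> V" for v
    proof -
      have "F v \<le> divisor_deg V F"
        unfolding divisor_deg_def using F(1) assms that
        by (intro member_le_sum) (auto simp: effective_divisors_def)
      with k F show ?thesis by simp
    qed
    with F(1) have "(\<lambda>v. D v + of_bool (v \<in> V) - F v) \<in> effective_divisors V"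
      by (auto simp: effective_divisors_def divisors_def D_def)
    moreover have "lin_equiv V E D' D'" for D'
      by (auto simp: lin_equiv_def laplacian_def intro!: exI[of _ "\<lambda>_. 0"])
    ultimately show False using F(3) by (auto simp: linear_system_def)
  qed
  then have "Inf (unwinnable_degrees V E (\<lambda>v. D v + of_bool (v \<in> V))) \<ge> 2"
    using unwinnable_degrees_nonempty[OF assms] by (intro cInf_greatest) auto
  then have "divisor_rank V E D \<ge> 1" by (simp add: divisor_rank_def modified_rank_def)
  with D show ?thesis by auto
qed

end

theory Submission imports Defs begin

text \<open>
  Write \<open>n\<close>, \<open>m\<close>, \<open>g\<close> for the numbers of vertices and edges and the genus. The bound follows from two
  general ones, \<open>gonality \<le> n\<close> and \<open>gonality \<le> g + 1\<close>, because
  \<open>\<lceil>(2\<kappa> - 1) g / (2\<kappa>) + 1\<rceil> \<ge> min n (g + 1)\<close> whenever \<open>\<kappa> \<ge> 1\<close> and \<open>\<kappa> m \<ge> n (n - 1)\<close>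
  (\<open>min_le_stretch_bound\<close>): if \<open>g < n\<close> then \<open>g < 2\<kappa>\<close>, so the left-hand side is at least \<open>g + 1\<close>; if
  \<open>g \<ge> n\<close>, elementary estimates show that it is at least \<open>n\<close>. A dense graph has \<open>\<kappa> = 1\<close>.

  The bound by \<open>n\<close> is witnessed by the divisor with coefficient 1 at every vertex. The bound by
  \<open>g + 1\<close> holds because every divisor of degree greater than \<open>m\<close> is linearly equivalent to an
  effective one (\<open>linear_system_nonempty\<close>): if \<open>D\<close> has degree \<open>g + 1\<close>, then \<open>D + \<Sum>(v) - F\<close> has degree
  greater than \<open>g + 1 + n - 2 = m\<close> for every \<open>F\<close> of degree less than 2.

  That fact has a variational proof. Denote by \<open>\<delta>\<close> the divisor of vertex degrees, by \<open>Q\<close> the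
  Laplacian, and let \<open>b\<close> be a divisor of degree 0. The energy \<open>f \<mapsto> \<langle>f, Q f\<rangle> / 2 - \<langle>b, f\<rangle>\<close> is bounded below
  on integer functions since the graph is connected. Lowering \<open>f\<close> by 1 at \<open>w\<close> changes the energy by
  \<open>b w - Q f w + \<delta> w / 2\<close>, so at an almost minimal \<open>f\<close> this quantity is almost nonnegative for every
  \<open>w\<close>: the divisor \<open>b + \<delta> / 2\<close>, which has degree \<open>m\<close>, is equivalent to an almost effective one. The
  excess over degree \<open>m\<close>, spread evenly over the vertices, absorbs the error.
\<close>

section \<open>Vertex degrees\<close>

text \<open>The number of edges at \<open>v\<close>, counted with multiplicity; a real, so that it can enter divisors.\<close>

definition vertex_degree :: "'a set \<Rightarrow> 'a set multiset \<Rightarrow> 'a \<Rightarrow> real" where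
  "vertex_degree V E v = (\<Sum>u\<in>V. real (count E {u, v}))"

lemma count_edge_eq_0:
  assumes "loopfree_multigraph V E" "u \<notin> V \<or> v \<notin> V \<or> u = v"
  shows "count E {u, v} = 0"
proof -
  have "{u, v} \<notin># E"
    using assms by (auto simp: loopfree_multigraph_def)
  then show ?thesis by (simp add: not_in_iff)
qed

lemma laplacian_outside:
  assumes "loopfree_multigraph V E" "v \<notin> V"
  shows "laplacian V E f v = 0"
  using assms by (simp add: laplacian_def count_edge_eq_0)

lemma laplacian_uminus: "laplacian V E (\<lambda>v. - f v) v = - laplacian V E f v"
  by (simp add: laplacian_def flip: sum_negf) (simp add: algebra_simps)

text \<open>The handshake lemma.\<close>

lemma sum_vertex_degree:
  assumes "loopfree_multigraph V E"
  shows "(\<Sum>v\<in>V. vertex_degree V E v) = 2 * real (size E)"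
  using assms
proof (induction E)
  case empty
  then show ?case by (simp add: vertex_degree_def)
next
  case (add e E)
  then have fin: "finite V" and e: "e \<subseteq> V" "card e = 2" and E: "loopfree_multigraph V E"
    by (auto simp: loopfree_multigraph_def)
  obtain a b where ab: "e = {a, b}" "a \<noteq> b"
    using e(2) by (auto simp: card_2_iff)
  have "(\<Sum>u\<in>V. (if e = {u, v} then 1 else 0 :: real)) = (if v = a then 1 else 0) + (if v = b then 1 else 0)"
    if "v \<in> V" for v
  proof -
    have "(\<Sum>u\<in>V. (if e = {u, v} then 1 else 0 :: real)) =
        (\<Sum>u\<in>V. (if u = b then if v = a then 1 else 0 else 0) + (if u = a then if v = b then 1 else 0 else 0))"
      using ab by (intro sum.cong) (auto simp: doubleton_eq_iff)
    then show ?thesis using fin e(1) ab by (simp add: sum.distrib)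
  qed
  then have "(\<Sum>v\<in>V. \<Sum>u\<in>V. (if e = {u, v} then 1 else 0 :: real)) = 2"
    using fin e(1) ab by (simp add: sum.distrib)
  moreover have "vertex_degree V (add_mset e E) v =
      (\<Sum>u\<in>V. (if e = {u, v} then 1 else 0)) + vertex_degree V E v" for v
    by (auto simp: vertex_degree_def simp flip: sum.distrib intro!: sum.cong)
  ultimately show ?case using add.IH[OF E] by (simp add: sum.distrib)
qed

section \<open>The energy of an integer function\<close>

text \<open>
  The quadratic form \<open>\<langle>f, Q f\<rangle>\<close> is the sum of \<open>(f v - f u)\<^sup>2\<close> over the edges. The double sum below meets
  every edge twice, so dividing it by 4 gives half the form.
\<close>

definition energy :: "'a set \<Rightarrow> 'a set multiset \<Rightarrow> ('a \<Rightarrow> real) \<Rightarrow> ('a \<Rightarrow> int) \<Rightarrow> real" where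
  "energy V E b f =
    (\<Sum>v\<in>V. \<Sum>u\<in>V. real (count E {u, v}) * (real_of_int (f v - f u))\<^sup>2) / 4 - (\<Sum>v\<in>V. b v * real_of_int (f v))"

text \<open>Twice the sum of \<open>\<bar>f v - f u\<bar>\<close> over the edges: the double sum again meets every edge twice.\<close>

definition variation :: "'a set \<Rightarrow> 'a set multiset \<Rightarrow> ('a \<Rightarrow> int) \<Rightarrow> real" where
  "variation V E f = (\<Sum>v\<in>V. \<Sum>u\<in>V. real (count E {u, v}) * \<bar>real_of_int (f v - f u)\<bar>)"

lemma energy_decrement:
  assumes G: "loopfree_multigraph V E" and w: "w \<in> V"
  shows "energy V E b (\<lambda>v. f v - of_bool (v = w)) - energy V E b f =
    b w - laplacian V E f w + vertex_degree V E w / 2"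
proof -
  have fin: "finite V" using G by (simp add: loopfree_multigraph_def)
  let ?c = "\<lambda>u v. real (count E {u, v})"
  let ?d = "\<lambda>u v. real_of_int (f v - f u)"
  let ?a = "\<lambda>v. of_bool (v = w) :: int"
  have "?c u v * (real_of_int (f v - ?a v - (f u - ?a u)))\<^sup>2 =
      ?c u v * (?d u v)\<^sup>2 + (if v = w then ?c u v * (1 - 2 * ?d u v) else 0)
        + (if u = w then ?c u v * (1 + 2 * ?d u v) else 0)" for u v
    using count_edge_eq_0[OF G, of w w]
    by (cases "v = w"; cases "u = w") (simp_all add: power2_eq_square algebra_simps)
  then have "(\<Sum>v\<in>V. \<Sum>u\<in>V. ?c u v * (real_of_int (f v - ?a v - (f u - ?a u)))\<^sup>2) =
      (\<Sum>v\<in>V. \<Sum>u\<in>V. ?c u v * (?d u v)\<^sup>2)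
        + (\<Sum>v\<in>V. \<Sum>u\<in>V. if v = w then ?c u v * (1 - 2 * ?d u v) else 0)
        + (\<Sum>v\<in>V. \<Sum>u\<in>V. if u = w then ?c u v * (1 + 2 * ?d u v) else 0)"
    by (simp add: sum.distrib)
  also have "(\<Sum>v\<in>V. \<Sum>u\<in>V. if v = w then ?c u v * (1 - 2 * ?d u v) else 0) =
      (\<Sum>u\<in>V. ?c u w * (1 - 2 * ?d u w))"
    using fin w by (subst sum.swap) simp
  also have "(\<Sum>v\<in>V. \<Sum>u\<in>V. if u = w then ?c u v * (1 + 2 * ?d u v) else 0) =
      (\<Sum>v\<in>V. ?c v w * (1 - 2 * ?d v w))"
    using fin w by (simp add: insert_commute algebra_simps)
  also have "(\<Sum>u\<in>V. ?c u w * (1 - 2 * ?d u w)) = vertex_degree V E w - 2 * laplacian V E f w"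
    by (simp add: vertex_degree_def laplacian_def sum_distrib_left algebra_simps flip: sum_subtractf)
  finally have quadratic: "(\<Sum>v\<in>V. \<Sum>u\<in>V. ?c u v * (real_of_int (f v - ?a v - (f u - ?a u)))\<^sup>2) =
      (\<Sum>v\<in>V. \<Sum>u\<in>V. ?c u v * (?d u v)\<^sup>2) + 2 * (vertex_degree V E w - 2 * laplacian V E f w)"
    by simp
  have "(\<Sum>v\<in>V. b v * real_of_int (f v - ?a v)) =
      (\<Sum>v\<in>V. b v * real_of_int (f v) - (if v = w then b v else 0))"
    by (intro sum.cong) (auto simp: algebra_simps)
  then have linear: "(\<Sum>v\<in>V. b v * real_of_int (f v - ?a v)) = (\<Sum>v\<in>V. b v * real_of_int (f v)) - b w"
    using fin w by (simp add: sum_subtractf)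
  show ?thesis
    unfolding energy_def quadratic linear by (simp add: field_simps)
qed

text \<open>
  Along a path, \<open>f\<close> changes by at most the number of steps times the total variation. The point is that
  the constant does not depend on \<open>f\<close>.
\<close>

lemma difference_le_variation:
  assumes G: "loopfree_multigraph V E" and path: "(q, v) \<in> {(x, y). {x, y} \<in># E}\<^sup>*"
  shows "\<exists>N. \<forall>f. \<bar>real_of_int (f v - f q)\<bar> \<le> N * variation V E f"
  using path
proof (induction rule: rtrancl_induct)
  case base
  then show ?case by (auto intro: exI[of _ 0])
next
  case (step y z)
  then obtain N where N: "\<And>f. \<bar>real_of_int (f y - f q)\<bar> \<le> N * variation V E f"
    by blast
  have yz: "{y, z} \<in># E" using step by simp
  then have V: "y \<in> V" "z \<in> V" and fin: "finite V"
    using G by (auto simp: loopfree_multigraph_def)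
  have le_variation: "\<bar>real_of_int (f z - f y)\<bar> \<le> variation V E f" for f
  proof -
    have "real (count E {y, z}) \<ge> 1" using yz by (simp add: Suc_le_eq)
    then have "\<bar>real_of_int (f z - f y)\<bar> \<le> real (count E {y, z}) * \<bar>real_of_int (f z - f y)\<bar>"
      using mult_right_mono[of 1 "real (count E {y, z})" "\<bar>real_of_int (f z - f y)\<bar>"] by simp
    also have "\<dots> \<le> (\<Sum>u\<in>V. real (count E {u, z}) * \<bar>real_of_int (f z - f u)\<bar>)"
      using V fin by (intro member_le_sum) auto
    also have "\<dots> \<le> variation V E f"
      unfolding variation_def using V fin
      by (intro member_le_sum[where f = "\<lambda>v. \<Sum>u\<in>V. real (count E {u, v}) * \<bar>real_of_int (f v - f u)\<bar>"])
        (auto intro: sum_nonneg)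
    finally show ?thesis .
  qed
  have "\<bar>real_of_int (f z - f q)\<bar> \<le> (N + 1) * variation V E f" for f
  proof -
    have "\<bar>real_of_int (f z - f q)\<bar> \<le> \<bar>real_of_int (f y - f q)\<bar> + \<bar>real_of_int (f z - f y)\<bar>"
      by simp
    also have "\<dots> \<le> N * variation V E f + variation V E f"
      using N le_variation by (rule add_mono)
    finally show ?thesis by (simp add: distrib_right)
  qed
  then show ?case by blast
qed

lemma linear_term_le_variation:
  assumes G: "loopfree_multigraph V E" and conn: "connected_multigraph V E"
    and b: "divisor_deg V b = 0"
  shows "\<exists>S. \<forall>f. (\<Sum>v\<in>V. b v * real_of_int (f v)) \<le> S * variation V E f"
proof -
  obtain q where q: "q \<in> V" using conn by (auto simp: connected_multigraph_def)
  have "\<forall>v\<in>V. \<exists>N. \<forall>f. \<bar>real_of_int (f v - f q)\<bar> \<le> N * variation V E f"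
    using conn q unfolding connected_multigraph_def by (intro ballI difference_le_variation[OF G]) blast
  then obtain N where N: "\<And>v f. v \<in> V \<Longrightarrow> \<bar>real_of_int (f v - f q)\<bar> \<le> N v * variation V E f"
    by metis
  define S where "S = (\<Sum>v\<in>V. \<bar>b v\<bar> * N v)"
  have "(\<Sum>v\<in>V. b v * real_of_int (f v)) \<le> S * variation V E f" for f
  proof -
    \<comment> \<open>As \<open>b\<close> has degree 0, adding a constant to \<open>f\<close> does not change the sum.\<close>
    have "(\<Sum>v\<in>V. b v * real_of_int (f v)) =
        (\<Sum>v\<in>V. b v * real_of_int (f v)) - divisor_deg V b * real_of_int (f q)"
      by (simp add: b)
    also have "\<dots> = (\<Sum>v\<in>V. b v * real_of_int (f v - f q))"
      by (simp add: divisor_deg_def sum_distrib_right sum_subtractf right_diff_distrib)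
    also have "\<dots> \<le> (\<Sum>v\<in>V. \<bar>b v\<bar> * (N v * variation V E f))"
    proof (rule sum_mono)
      fix v assume "v \<in> V"
      have "b v * real_of_int (f v - f q) \<le> \<bar>b v\<bar> * \<bar>real_of_int (f v - f q)\<bar>"
        by (metis abs_ge_self abs_mult)
      also have "\<dots> \<le> \<bar>b v\<bar> * (N v * variation V E f)"
        using N[OF \<open>v \<in> V\<close>] by (intro mult_left_mono) auto
      finally show "b v * real_of_int (f v - f q) \<le> \<bar>b v\<bar> * (N v * variation V E f)" .
    qed
    also have "\<dots> = S * variation V E f"
      by (simp add: S_def sum_distrib_right mult.assoc)
    finally show ?thesis .
  qed
  then show ?thesis by blast
qed

text \<open>
  The linear term is at most a constant times the sum of the \<open>\<bar>f v - f u\<bar>\<close>, so it is dominated edge by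
  edge by the quadratic term, up to a constant.
\<close>

lemma energy_bdd_below:
  assumes "loopfree_multigraph V E" "connected_multigraph V E" "divisor_deg V b = 0"
  shows "bdd_below (range (energy V E b))"
proof -
  let ?c = "\<lambda>u v. real (count E {u, v})"
  obtain S where S: "\<And>f. (\<Sum>v\<in>V. b v * real_of_int (f v)) \<le> S * variation V E f"
    using linear_term_le_variation[OF assms] by blast
  have "- (\<Sum>v\<in>V. \<Sum>u\<in>V. ?c u v * S\<^sup>2) \<le> energy V E b f" for f
  proof -
    let ?d = "\<lambda>u v. \<bar>real_of_int (f v - f u)\<bar>"
    have "- (\<Sum>v\<in>V. \<Sum>u\<in>V. ?c u v * S\<^sup>2) = (\<Sum>v\<in>V. \<Sum>u\<in>V. ?c u v * - S\<^sup>2)"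
      by (simp add: sum_negf)
    also have "\<dots> \<le> (\<Sum>v\<in>V. \<Sum>u\<in>V. ?c u v * ((?d u v)\<^sup>2 / 4 - S * ?d u v))"
    proof (intro sum_mono mult_left_mono)
      \<comment> \<open>Completing the square.\<close>
      show "- S\<^sup>2 \<le> (?d u v)\<^sup>2 / 4 - S * ?d u v" for u v
        using zero_le_power2[of "?d u v / 2 - S"] unfolding power2_diff power_divide
        by (simp add: mult.commute)
    qed simp
    also have "\<dots> = (\<Sum>v\<in>V. \<Sum>u\<in>V. ?c u v * (real_of_int (f v - f u))\<^sup>2) / 4 - S * variation V E f"
      unfolding variation_def sum_distrib_left sum_divide_distrib sum_subtractf[symmetric]
      by (intro sum.cong) (simp_all add: right_diff_distrib)
    also have "\<dots> \<le> energy V E b f"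
      unfolding energy_def using S[of f] by simp
    finally show ?thesis .
  qed
  then show ?thesis by (intro bdd_belowI2)
qed

section \<open>Divisors of degree greater than the number of edges\<close>

text \<open>
  No integrality is assumed: this is the counterpart for real divisors of the fact that an integral
  divisor of degree at least the genus is linearly equivalent to an effective one.
\<close>

lemma linear_system_nonempty:
  assumes G: "loopfree_multigraph V E" and conn: "connected_multigraph V E"
    and D: "D \<in> divisors V" and deg: "divisor_deg V D > real (size E)"
  shows "linear_system V E D \<noteq> {}"
proof -
  have n: "card V > 0"
    using G conn by (auto simp: loopfree_multigraph_def connected_multigraph_def card_gt_0_iff)
  define \<epsilon> where "\<epsilon> = (divisor_deg V D - real (size E)) / real (card V)"
  have eps: "\<epsilon> > 0" using n deg by (simp add: \<epsilon>_def)
  \<comment> \<open>Subtracting \<open>\<epsilon>\<close> at every vertex leaves a divisor \<open>b\<close> of degree exactly 0.\<close>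
  define b where "b v = D v - vertex_degree V E v / 2 - \<epsilon>" for v
  have "divisor_deg V b = divisor_deg V D - (\<Sum>v\<in>V. vertex_degree V E v) / 2 - real (card V) * \<epsilon>"
    by (simp add: divisor_deg_def b_def sum_subtractf sum_divide_distrib)
  also have "\<dots> = 0"
    using n by (simp add: sum_vertex_degree[OF G] \<epsilon>_def)
  finally have bdd: "bdd_below (range (energy V E b))"
    by (rule energy_bdd_below[OF G conn])
  obtain f where "energy V E b f < Inf (range (energy V E b)) + \<epsilon>"
    using cInf_lessD[of "range (energy V E b)" "Inf (range (energy V E b)) + \<epsilon>"] eps by auto
  then have f: "energy V E b f < energy V E b h + \<epsilon>" for h
    using cInf_lower[OF rangeI bdd, of h] by linarith
  have "D w + laplacian V E (\<lambda>v. - f v) w \<ge> 0" if "w \<in> V" for w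
    using energy_decrement[OF G that, of b f] f[of "\<lambda>v. f v - of_bool (v = w)"]
    by (simp add: b_def laplacian_uminus)
  moreover have "D w + laplacian V E (\<lambda>v. - f v) w = 0" if "w \<notin> V" for w
    using D that by (simp add: divisors_def laplacian_outside[OF G])
  ultimately have "(\<lambda>w. D w + laplacian V E (\<lambda>v. - f v) w) \<in> linear_system V E D"
    by (auto simp: linear_system_def effective_divisors_def divisors_def lin_equiv_def)
  then show ?thesis by blast
qed

section \<open>Two upper bounds for the gonality\<close>

lemma gonality_le_degI:
  assumes V: "finite V" "V \<noteq> {}" and D: "D \<in> divisors V"
    and sys: "\<And>F. F \<in> effective_divisors V \<Longrightarrow> divisor_deg V F < 2 \<Longrightarrow>
      linear_system V E (\<lambda>v. D v + of_bool (v \<in> V) - F v) \<noteq> {}"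
  shows "gonality V E \<le> divisor_deg V D"
proof -
  have "k \<ge> 2" if "k \<in> unwinnable_degrees V E (\<lambda>v. D v + of_bool (v \<in> V))" for k
    using that sys by (force simp: unwinnable_degrees_def)
  then have "Inf (unwinnable_degrees V E (\<lambda>v. D v + of_bool (v \<in> V))) \<ge> 2"
    using unwinnable_degrees_nonempty[OF V] by (intro cInf_greatest) auto
  then have "divisor_rank V E D \<ge> 1" by (simp add: divisor_rank_def modified_rank_def)
  then show ?thesis
    unfolding gonality_def using D by (intro cInf_lower bdd_below_degrees_rank_ge_1) auto
qed

lemma gonality_le_card:
  assumes V: "finite V" "V \<noteq> {}"
  shows "gonality V E \<le> real (card V)"
proof -
  define D :: "'a \<Rightarrow> real" where "D = (\<lambda>v. of_bool (v \<in> V))"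
  have "linear_system V E (\<lambda>v. D v + of_bool (v \<in> V) - F v) \<noteq> {}"
    if F: "F \<in> effective_divisors V" "divisor_deg V F < 2" for F
  proof -
    have "F v < 2" if "v \<in> V" for v
    proof -
      have "F v \<le> divisor_deg V F"
        unfolding divisor_deg_def using F(1) V that
        by (intro member_le_sum) (auto simp: effective_divisors_def)
      with F(2) show ?thesis by simp
    qed
    then have "(\<lambda>v. D v + of_bool (v \<in> V) - F v) \<in> effective_divisors V"
      using F(1) by (force simp: effective_divisors_def divisors_def D_def)
    then have "(\<lambda>v. D v + of_bool (v \<in> V) - F v) \<in> linear_system V E (\<lambda>v. D v + of_bool (v \<in> V) - F v)"
      by (auto simp: linear_system_def lin_equiv_def laplacian_def intro!: exI[of _ "\<lambda>_. 0"])
    then show ?thesis by blast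
  qed
  then have "gonality V E \<le> divisor_deg V D"
    by (intro gonality_le_degI V) (auto simp: D_def divisors_def)
  then show ?thesis by (simp add: divisor_deg_def D_def)
qed

lemma gonality_le_genus_plus_1:
  assumes G: "loopfree_multigraph V E" and conn: "connected_multigraph V E"
  shows "gonality V E \<le> of_int (genus V E) + 1"
proof -
  have V: "finite V" "V \<noteq> {}"
    using G conn by (auto simp: loopfree_multigraph_def connected_multigraph_def)
  obtain q where q: "q \<in> V" using V by blast
  define D :: "'a \<Rightarrow> real" where "D = (\<lambda>v. if v = q then of_int (genus V E) + 1 else 0)"
  have D: "D \<in> divisors V" "divisor_deg V D = of_int (genus V E) + 1"
    using V q by (auto simp: D_def divisors_def divisor_deg_def)
  have "linear_system V E (\<lambda>v. D v + of_bool (v \<in> V) - F v) \<noteq> {}"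
    if F: "F \<in> effective_divisors V" "divisor_deg V F < 2" for F
  proof (rule linear_system_nonempty[OF G conn])
    show "(\<lambda>v. D v + of_bool (v \<in> V) - F v) \<in> divisors V"
      using D(1) F(1) by (auto simp: effective_divisors_def divisors_def)
    have "divisor_deg V (\<lambda>v. D v + of_bool (v \<in> V) - F v) =
        divisor_deg V D + real (card V) - divisor_deg V F"
      by (simp add: divisor_deg_def sum.distrib sum_subtractf)
    then show "divisor_deg V (\<lambda>v. D v + of_bool (v \<in> V) - F v) > real (size E)"
      using D(2) F(2) by (simp add: genus_def)
  qed
  then show ?thesis by (rule gonality_le_degI[OF V D(1), unfolded D(2)])
qed

section \<open>Comparison with the stretch factor bound\<close>

lemma min_le_stretch_bound:
  fixes n g \<kappa> :: int
  assumes n: "n \<ge> 2" and g: "g \<ge> 1" and \<kappa>1: "\<kappa> \<ge> 1"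
    and \<kappa>: "n * (n - 1) \<le> \<kappa> * (n - 1 + g)"
  shows "min n (g + 1) \<le> \<lceil>(2 * of_int \<kappa> - 1) * of_int g / (2 * of_int \<kappa>) + 1 :: real\<rceil>"
proof -
  define j where "j = g - n"
  \<comment> \<open>With \<open>k = min n (g + 1)\<close>, this says \<open>g / (2 \<kappa>) < g + 2 - k\<close> with the denominator cleared.\<close>
  have "g < 2 * \<kappa> * (g + 2 - min n (g + 1))"
  proof (cases "g < n")
    case True
    have "g * (n - 1 + g) \<le> (n - 1) * (2 * (n - 1))"
      using True g n by (intro mult_mono) auto
    also have "\<dots> < 2 * (n * (n - 1))"
      using n by (simp add: algebra_simps)
    also have "\<dots> \<le> (2 * \<kappa>) * (n - 1 + g)"
      using \<kappa> by simp
    finally have "g < 2 * \<kappa>"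
      using n g by (simp add: mult_less_cancel_right)
    moreover have "min n (g + 1) = g + 1" using True by simp
    ultimately show ?thesis by simp
  next
    case False
    then have j: "j \<ge> 0" "g = n + j" by (auto simp: j_def)
    have "g < 2 * \<kappa> * (j + 2)"
    proof (cases "j \<ge> n - 3")
      case True
      have "2 * (j + 2) \<le> 2 * \<kappa> * (j + 2)"
        using j(1) \<kappa>1 by (intro mult_right_mono) auto
      moreover have "g < 2 * (j + 2)" using True j by simp
      ultimately show ?thesis by (rule less_le_trans[rotated])
    next
      case False
      have n4: "n \<ge> 4" using False j(1) by simp
      then have nn: "8 * n \<le> 2 * (n * n)" by simp
      then have "2 * (n * n) - 5 * n + 1 - j \<ge> 0" using False n4 by linarith
      then have "j * (2 * (n * n) - 5 * n + 1 - j) \<ge> 0"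
        using j(1) by (rule mult_nonneg_nonneg[rotated])
      moreover have "2 * (n * (n - 1)) * (j + 2) - g * (n - 1 + g) =
          j * (2 * (n * n) - 5 * n + 1 - j) + (2 * (n * n) - 3 * n)"
        unfolding j(2) by (simp add: algebra_simps)
      ultimately have "g * (n - 1 + g) < 2 * (n * (n - 1)) * (j + 2)"
        using nn n4 by linarith
      also have "\<dots> \<le> 2 * (\<kappa> * (n - 1 + g)) * (j + 2)"
        using \<kappa> j(1) by (intro mult_right_mono) auto
      also have "\<dots> = (2 * \<kappa> * (j + 2)) * (n - 1 + g)"
        by (simp add: algebra_simps)
      finally show ?thesis
        using n g by (simp add: mult_less_cancel_right)
    qed
    then show ?thesis using j by (simp add: min_def algebra_simps)
  qed
  then have "real_of_int g < real_of_int (2 * \<kappa> * (g + 2 - min n (g + 1)))"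
    by (simp only: of_int_less_iff)
  then have "real_of_int g < 2 * of_int \<kappa> * (of_int g + 2 - of_int (min n (g + 1)))"
    by (simp del: of_int_min)
  then have "real_of_int (min n (g + 1)) - 1 < (2 * of_int \<kappa> - 1) * of_int g / (2 * of_int \<kappa>) + 1"
    using \<kappa>1 by (simp add: field_simps del: of_int_min)
  then show ?thesis by (simp only: le_ceiling_iff)
qed

theorem theorem1p8:
  fixes V :: "'a set" and E :: "'a set multiset"
  assumes "loopfree_multigraph V E"
    and "connected_multigraph V E"
    and "card V \<ge> 2"
    and "genus V E \<ge> 1"
  shows "(dense_multigraph V E \<longrightarrow> gonality V E \<le> of_int \<lceil>(of_int (genus V E) + 2) / 2 :: real\<rceil>) \<and>
    (\<forall>\<kappa>. \<kappa> = stretch_factor V E \<longrightarrow>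
      gonality V E \<le> of_int \<lceil>(2 * of_int \<kappa> - 1) * of_int (genus V E) / (2 * of_int \<kappa>) + 1 :: real\<rceil>)"
proof -
  let ?n = "int (card V)" and ?g = "genus V E"
  have V: "finite V" "V \<noteq> {}"
    using assms by (auto simp: loopfree_multigraph_def connected_multigraph_def)
  have m: "int (size E) = ?n - 1 + ?g"
    by (simp add: genus_def)
  then have m_pos: "size E > 0" using assms(3,4) by linarith
  have nn: "int (card V * (card V - 1)) = ?n * (?n - 1)"
    using assms(3) by (simp add: of_nat_diff)
  have bound: "gonality V E \<le> of_int \<lceil>(2 * of_int \<kappa> - 1) * of_int ?g / (2 * of_int \<kappa>) + 1 :: real\<rceil>"
    if "\<kappa> \<ge> 1" "?n * (?n - 1) \<le> \<kappa> * (?n - 1 + ?g)" for \<kappa> :: int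
  proof -
    have "gonality V E \<le> of_int (min ?n (?g + 1))"
      using gonality_le_card[OF V, of E] gonality_le_genus_plus_1[OF assms(1,2)] by simp
    also have "\<dots> \<le> of_int \<lceil>(2 * of_int \<kappa> - 1) * of_int ?g / (2 * of_int \<kappa>) + 1 :: real\<rceil>"
      using min_le_stretch_bound[of ?n ?g \<kappa>] assms(3,4) that by (subst of_int_le_iff) simp
    finally show ?thesis .
  qed
  have "gonality V E \<le> of_int \<lceil>(of_int ?g + 2) / 2 :: real\<rceil>" if "dense_multigraph V E"
  proof -
    have "int (card V * (card V - 1)) \<le> int (size E)"
      using that unfolding dense_multigraph_def by (simp only: of_nat_le_iff)
    then have "?n * (?n - 1) \<le> 1 * (?n - 1 + ?g)"
      unfolding nn m by simp
    from bound[OF _ this] show ?thesis by (simp add: add_divide_distrib)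
  qed
  moreover have "gonality V E \<le>
      of_int \<lceil>(2 * of_int \<kappa> - 1) * of_int ?g / (2 * of_int \<kappa>) + 1 :: real\<rceil>"
    if "\<kappa> = stretch_factor V E" for \<kappa>
  proof (rule bound)
    show "\<kappa> \<ge> 1" using that by (simp add: stretch_factor_def)
    have "real (card V * (card V - 1)) / real (size E) \<le> of_int \<kappa>"
      unfolding that stretch_factor_def by (simp add: ceiling_le_iff[symmetric] del: of_nat_mult)
    then have "real (card V * (card V - 1)) \<le> of_int \<kappa> * real (size E)"
      using m_pos by (simp add: divide_le_eq del: of_nat_mult)
    then have "real_of_int (int (card V * (card V - 1))) \<le> real_of_int (\<kappa> * int (size E))"
      by (simp only: of_int_mult of_int_of_nat_eq)
    then have "int (card V * (card V - 1)) \<le> \<kappa> * int (size E)"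
      by (simp only: of_int_le_iff)
    then show "?n * (?n - 1) \<le> \<kappa> * (?n - 1 + ?g)"
      unfolding nn m .
  qed
  ultimately show ?thesis by blast
qed

end
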